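(* For any nominal transition system $\mathbf T$ with a distinguished action $\tau$ and states $P,Q$: if $P\stackrel{\cdot}{\approx}_{\mathcal S(\mathbf T)}Q$ then $P\stackrel{\cdot}{\approx}_{\mathbf T}Q$.
   Context: Nominal sets over a countably infinite (possibly sorted) set of names $\mathcal N$: permutations fix all but finitely many names; every element has finite support $\operatorname{supp}$; $a\# X$ means $a\notin\operatorname{supp}(X)$; $[\mathcal P_{\mathrm{fin}}(\mathcal N)]S$ is $\mathcal P_{\mathrm{fin}}(\mathcal N)\times S$ modulo $(N,X)=_\alpha(N',X')$ iff some $\pi$ with $\pi\cdot(N,X)=(N',X')$ fixes every name of $\operatorname{supp}(X)\setminus N$; classes $\langle N\rangle X$. A nominal transition system: nominal sets STATES, PRED, ACT; equivariant $\vdash\subseteq\mathrm{STATES}\times\mathrm{PRED}$; equivariant $\operatorname{bn}$, $\operatorname{bn}(\alpha)$ a finite subset of $\operatorname{supp}(\alpha)$; equivariant $\rightarrow\ \subseteq\mathrm{STATES}\times[\mathcal P_{\mathrm{fin}}(\mathcal N)](\mathrm{ACT}\times\mathrm{STATES})$ with $(P,\langle N\rangle(\alpha,Q))\in\rightarrow$ only if $N=\operatorname{bn}(\alpha)$; $P\xrightarrow{\alpha}P'$ means $(P,\langle\operatorname{bn}(\alpha)\rangle(\alpha,P'))\in\rightarrow$. $\tau\in\mathrm{ACT}$ is a special action with empty support. Weak transitions: $P\Rightarrow P'$ iff $P=P'$ or $P\xrightarrow{\tau}P''\Rightarrow P'$; $P\stackrel{\alpha}{\Rightarrow}P'$ iff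 $P\Rightarrow\circ\xrightarrow{\alpha}\circ\Rightarrow P'$; $P\stackrel{\hat\alpha}{\Rightarrow}P'$ is $P\Rightarrow P'$ if $\alpha=\tau$, else $P\stackrel{\alpha}{\Rightarrow}P'$. A weak bisimulation is a symmetric relation $R$ with: $R(P,Q)$ implies (weak simulation) whenever $\operatorname{bn}(\alpha)\# Q$ and $P\xrightarrow{\alpha}P'$, some $Q'$ has $Q\stackrel{\hat\alpha}{\Rightarrow}Q'$ and $R(P',Q')$; (weak static implication) whenever $P\vdash\varphi$, some $Q'$ has $Q\Rightarrow Q'$, $Q'\vdash\varphi$, $R(P,Q')$. $\stackrel{\cdot}{\approx}_{\mathbf T}$ is weak bisimilarity in $\mathbf T$. $\mathcal S(\mathbf T)$ is the nominal transition system with: same states as $\mathbf T$; actions $\mathrm{ACT}_{\mathbf T}\uplus\mathrm{PRED}_{\mathbf T}$ (so $\tau$ is also its distinguished action); $\operatorname{bn}$ as in $\mathbf T$ on $\mathrm{ACT}_{\mathbf T}$ and $\operatorname{bn}(\varphi)=\emptyset$ for $\varphi\in\mathrm{PRED}_{\mathbf T}$; no state predicates hold; transitions $P\xrightarrow{\alpha}P'$ iff $P\xrightarrow{\alpha}P'$ in $\mathbf T$ (for $\alpha\in\mathrm{ACT}_{\mathbf T}$), and $P\xrightarrow{\varphi}P$ iff $P\vdash_{\mathbf T}\varphi$, with no other $\varphi$-transitions. *)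

theory Defs
  imports Main "HOL-Library.Countable_Set" "HOL-Combinatorics.Perm"
begin

text \<open>
  Names are the elements of a countably infinite type \<open>'n\<close>, and \<open>srt\<close> assigns a sort to each name.
  Each inhabited sort is infinite; the unsorted case is the one of a constant \<open>srt\<close>.
  The type \<open>'n perm\<close> consists of the bijections that fix all but finitely many names. Only the
  sort-respecting ones among them count as permutations of names.
\<close>

definition name_sorting :: "('n \<Rightarrow> 's) \<Rightarrow> bool" where
  "name_sorting srt \<longleftrightarrow> countable (UNIV :: 'n set) \<and> (\<forall>a. infinite {b. srt b = srt a})"

definition perms :: "('n \<Rightarrow> 's) \<Rightarrow> 'n perm set" where
  "perms srt = {\<pi>. \<forall>a. srt (Perm.apply \<pi> a) = srt a}"

record ('n, 'a) permset =
  carrier :: "'a set"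
  act :: "'n perm \<Rightarrow> 'a \<Rightarrow> 'a"

definition supports :: "('n \<Rightarrow> 's) \<Rightarrow> ('n, 'a) permset \<Rightarrow> 'n set \<Rightarrow> 'a \<Rightarrow> bool" where
  "supports srt X N x \<longleftrightarrow>
     (\<forall>\<pi>\<in>perms srt. (\<forall>a\<in>N. Perm.apply \<pi> a = a) \<longrightarrow> act X \<pi> x = x)"

text \<open>The support is the least finite set of names that supports the element.\<close>

definition supp :: "('n \<Rightarrow> 's) \<Rightarrow> ('n, 'a) permset \<Rightarrow> 'a \<Rightarrow> 'n set" where
  "supp srt X x = \<Inter>{N. finite N \<and> supports srt X N x}"

definition nominal_set :: "('n \<Rightarrow> 's) \<Rightarrow> ('n, 'a) permset \<Rightarrow> bool" where
  "nominal_set srt X \<longleftrightarrow>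
     (\<forall>\<pi>\<in>perms srt. \<forall>x\<in>carrier X. act X \<pi> x \<in> carrier X) \<and>
     (\<forall>x\<in>carrier X. act X 1 x = x) \<and>
     (\<forall>\<pi>\<in>perms srt. \<forall>\<rho>\<in>perms srt. \<forall>x\<in>carrier X. act X (\<pi> * \<rho>) x = act X \<pi> (act X \<rho> x)) \<and>
     (\<forall>x\<in>carrier X. \<exists>N. finite N \<and> supports srt X N x)"

definition equivariant :: "('n \<Rightarrow> 's) \<Rightarrow> ('n, 'a) permset \<Rightarrow> 'a set \<Rightarrow> bool" where
  "equivariant srt X U \<longleftrightarrow> (\<forall>\<pi>\<in>perms srt. \<forall>x\<in>U. act X \<pi> x \<in> U)"

definition fin_names :: "('n, 'n set) permset" where
  "fin_names = \<lparr>carrier = {N. finite N}, act = (\<lambda>\<pi> N. Perm.apply \<pi> ` N)\<rparr>"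

definition prod_permset :: "('n, 'a) permset \<Rightarrow> ('n, 'b) permset \<Rightarrow> ('n, 'a \<times> 'b) permset" where
  "prod_permset X Y =
     \<lparr>carrier = carrier X \<times> carrier Y, act = (\<lambda>\<pi>. map_prod (act X \<pi>) (act Y \<pi>))\<rparr>"

definition sum_permset :: "('n, 'a) permset \<Rightarrow> ('n, 'b) permset \<Rightarrow> ('n, 'a + 'b) permset" where
  "sum_permset X Y =
     \<lparr>carrier = carrier X <+> carrier Y, act = (\<lambda>\<pi>. map_sum (act X \<pi>) (act Y \<pi>))\<rparr>"

definition alpha_rel ::
    "('n \<Rightarrow> 's) \<Rightarrow> ('n, 'a) permset \<Rightarrow> (('n set \<times> 'a) \<times> ('n set \<times> 'a)) set" where
  "alpha_rel srt X =
     {((N, x), (N', x')).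
        (N, x) \<in> carrier (prod_permset fin_names X) \<and>
        (N', x') \<in> carrier (prod_permset fin_names X) \<and>
        (\<exists>\<pi>\<in>perms srt. act (prod_permset fin_names X) \<pi> (N, x) = (N', x') \<and>
           (\<forall>a\<in>supp srt X x - N. Perm.apply \<pi> a = a))}"

definition abstr :: "('n \<Rightarrow> 's) \<Rightarrow> ('n, 'a) permset \<Rightarrow> 'n set \<Rightarrow> 'a \<Rightarrow> ('n set \<times> 'a) set" where
  "abstr srt X N x = alpha_rel srt X `` {(N, x)}"

definition abstr_permset ::
    "('n \<Rightarrow> 's) \<Rightarrow> ('n, 'a) permset \<Rightarrow> ('n, ('n set \<times> 'a) set) permset" where
  "abstr_permset srt X =
     \<lparr>carrier = carrier (prod_permset fin_names X) // alpha_rel srt X,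
      act = (\<lambda>\<pi> C. act (prod_permset fin_names X) \<pi> ` C)\<rparr>"

record ('n, 'st, 'pr, 'ac) nts =
  states :: "('n, 'st) permset"
  preds :: "('n, 'pr) permset"
  acts :: "('n, 'ac) permset"
  sat :: "('st \<times> 'pr) set"
  bn :: "'ac \<Rightarrow> 'n set"
  transitions :: "('st \<times> ('n set \<times> ('ac \<times> 'st)) set) set"

abbreviation residuals :: "('n, 'st, 'pr, 'ac) nts \<Rightarrow> ('n, 'ac \<times> 'st) permset" where
  "residuals T \<equiv> prod_permset (acts T) (states T)"

definition nominal_transition_system ::
    "('n \<Rightarrow> 's) \<Rightarrow> ('n, 'st, 'pr, 'ac) nts \<Rightarrow> bool" where
  "nominal_transition_system srt T \<longleftrightarrow>
     nominal_set srt (states T) \<and> nominal_set srt (preds T) \<and> nominal_set srt (acts T) \<and>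
     sat T \<subseteq> carrier (states T) \<times> carrier (preds T) \<and>
     equivariant srt (prod_permset (states T) (preds T)) (sat T) \<and>
     (\<forall>\<pi>\<in>perms srt. \<forall>\<alpha>\<in>carrier (acts T).
        bn T (act (acts T) \<pi> \<alpha>) = Perm.apply \<pi> ` bn T \<alpha>) \<and>
     (\<forall>\<alpha>\<in>carrier (acts T). finite (bn T \<alpha>) \<and> bn T \<alpha> \<subseteq> supp srt (acts T) \<alpha>) \<and>
     transitions T \<subseteq> carrier (states T) \<times> carrier (abstr_permset srt (residuals T)) \<and>
     equivariant srt (prod_permset (states T) (abstr_permset srt (residuals T))) (transitions T) \<and>
     (\<forall>P N. \<forall>\<alpha>\<in>carrier (acts T). \<forall>Q\<in>carrier (states T).
        finite N \<longrightarrow> (P, abstr srt (residuals T) N (\<alpha>, Q)) \<in> transitions T \<longrightarrow> N = bn T \<alpha>)"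

definition step ::
    "('n \<Rightarrow> 's) \<Rightarrow> ('n, 'st, 'pr, 'ac) nts \<Rightarrow> 'st \<Rightarrow> 'ac \<Rightarrow> 'st \<Rightarrow> bool" where
  "step srt T P \<alpha> P' \<longleftrightarrow>
     \<alpha> \<in> carrier (acts T) \<and> P' \<in> carrier (states T) \<and>
     (P, abstr srt (residuals T) (bn T \<alpha>) (\<alpha>, P')) \<in> transitions T"

inductive weak_tau ::
    "('n \<Rightarrow> 's) \<Rightarrow> ('n, 'st, 'pr, 'ac) nts \<Rightarrow> 'ac \<Rightarrow> 'st \<Rightarrow> 'st \<Rightarrow> bool"
  for srt T \<tau> where
  refl: "weak_tau srt T \<tau> P P"
| step: "step srt T P \<tau> P'' \<Longrightarrow> weak_tau srt T \<tau> P'' P' \<Longrightarrow> weak_tau srt T \<tau> P P'"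

definition weak_step ::
    "('n \<Rightarrow> 's) \<Rightarrow> ('n, 'st, 'pr, 'ac) nts \<Rightarrow> 'ac \<Rightarrow> 'st \<Rightarrow> 'ac \<Rightarrow> 'st \<Rightarrow> bool" where
  "weak_step srt T \<tau> P \<alpha> P' \<longleftrightarrow>
     (\<exists>P1 P2. weak_tau srt T \<tau> P P1 \<and> step srt T P1 \<alpha> P2 \<and> weak_tau srt T \<tau> P2 P')"

definition weak_hat_step ::
    "('n \<Rightarrow> 's) \<Rightarrow> ('n, 'st, 'pr, 'ac) nts \<Rightarrow> 'ac \<Rightarrow> 'st \<Rightarrow> 'ac \<Rightarrow> 'st \<Rightarrow> bool" where
  "weak_hat_step srt T \<tau> P \<alpha> P' \<longleftrightarrow>
     (if \<alpha> = \<tau> then weak_tau srt T \<tau> P P' else weak_step srt T \<tau> P \<alpha> P')"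

definition weak_bisimulation ::
    "('n \<Rightarrow> 's) \<Rightarrow> ('n, 'st, 'pr, 'ac) nts \<Rightarrow> 'ac \<Rightarrow> ('st \<times> 'st) set \<Rightarrow> bool" where
  "weak_bisimulation srt T \<tau> R \<longleftrightarrow>
     R \<subseteq> carrier (states T) \<times> carrier (states T) \<and> sym R \<and>
     (\<forall>(P, Q)\<in>R.
        (\<forall>\<alpha>\<in>carrier (acts T). \<forall>P'.
           bn T \<alpha> \<inter> supp srt (states T) Q = {} \<longrightarrow> step srt T P \<alpha> P' \<longrightarrow>
           (\<exists>Q'. weak_hat_step srt T \<tau> Q \<alpha> Q' \<and> (P', Q') \<in> R)) \<and>
        (\<forall>\<phi>. (P, \<phi>) \<in> sat T \<longrightarrow>
           (\<exists>Q'. weak_tau srt T \<tau> Q Q' \<and> (Q', \<phi>) \<in> sat T \<and> (P, Q') \<in> R)))"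

definition weakly_bisimilar ::
    "('n \<Rightarrow> 's) \<Rightarrow> ('n, 'st, 'pr, 'ac) nts \<Rightarrow> 'ac \<Rightarrow> 'st \<Rightarrow> 'st \<Rightarrow> bool" where
  "weakly_bisimilar srt T \<tau> P Q \<longleftrightarrow> (\<exists>R. weak_bisimulation srt T \<tau> R \<and> (P, Q) \<in> R)"

definition preds_to_acts ::
    "('n \<Rightarrow> 's) \<Rightarrow> ('n, 'st, 'pr, 'ac) nts \<Rightarrow> ('n, 'st, 'pr, 'ac + 'pr) nts" where
  "preds_to_acts srt T =
     (let A = sum_permset (acts T) (preds T); X = prod_permset A (states T) in
      \<lparr>states = states T,
       preds = \<lparr>carrier = {}, act = act (preds T)\<rparr>,
       acts = A,
       sat = {},
       bn = case_sum (bn T) (\<lambda>_. {}),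
       transitions =
         {(P, abstr srt X (bn T \<alpha>) (Inl \<alpha>, P')) | P \<alpha> P'. step srt T P \<alpha> P'} \<union>
         {(P, abstr srt X {} (Inr \<phi>, P)) | P \<phi>. (P, \<phi>) \<in> sat T}\<rparr>)"

lemma perms_one: "1 \<in> perms srt"
  by (simp add: perms_def)

lemma perms_times: "\<pi> \<in> perms srt \<Longrightarrow> \<rho> \<in> perms srt \<Longrightarrow> \<pi> * \<rho> \<in> perms srt"
  by (simp add: perms_def apply_times)

lemma apply_inverse_left [simp]: "Perm.apply (inverse \<pi>) (Perm.apply \<pi> a) = a"
  by (simp add: apply_inverse bij_is_inj)

lemma apply_inverse_right [simp]: "Perm.apply \<pi> (Perm.apply (inverse \<pi>) a) = a"
  by (simp add: apply_inverse bij_is_surj surj_f_inv_f)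

lemma inverse_perm_left: "inverse \<pi> * \<pi> = (1 :: 'n perm)"
  by (rule perm_eqI) (simp add: apply_times)

lemma inverse_perm_right: "\<pi> * inverse \<pi> = (1 :: 'n perm)"
  by (rule perm_eqI) (simp add: apply_times)

lemma perms_inverse: "\<pi> \<in> perms srt \<Longrightarrow> inverse \<pi> \<in> perms srt"
proof -
  assume p: "\<pi> \<in> perms srt"
  have "srt (Perm.apply (inverse \<pi>) a) = srt a" for a
  proof -
    have "srt (Perm.apply \<pi> (Perm.apply (inverse \<pi>) a)) = srt (Perm.apply (inverse \<pi>) a)"
      using p unfolding perms_def by blast
    then show ?thesis by simp
  qed
  then show ?thesis unfolding perms_def by blast
qed

lemma nominal_setD:
  assumes "nominal_set srt X"
  shows "\<pi> \<in> perms srt \<Longrightarrow> x \<in> carrier X \<Longrightarrow> act X \<pi> x \<in> carrier X"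
    and "x \<in> carrier X \<Longrightarrow> act X 1 x = x"
    and "\<pi> \<in> perms srt \<Longrightarrow> \<rho> \<in> perms srt \<Longrightarrow> x \<in> carrier X \<Longrightarrow>
           act X (\<pi> * \<rho>) x = act X \<pi> (act X \<rho> x)"
    and "x \<in> carrier X \<Longrightarrow> \<exists>N. finite N \<and> supports srt X N x"
  using assms unfolding nominal_set_def by blast+

lemma act_inverse_left:
  assumes "nominal_set srt X" "\<pi> \<in> perms srt" "x \<in> carrier X"
  shows "act X (inverse \<pi>) (act X \<pi> x) = x"
  using nominal_setD(3)[OF assms(1) perms_inverse[OF assms(2)] assms(2,3)] nominal_setD(2)[OF assms(1,3)]
  by (simp add: inverse_perm_left)

lemma supports_act:
  assumes X: "nominal_set srt X" and p: "\<pi> \<in> perms srt" and x: "x \<in> carrier X"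
    and s: "supports srt X N x"
  shows "supports srt X (Perm.apply \<pi> ` N) (act X \<pi> x)"
  unfolding supports_def
proof (intro ballI impI)
  fix \<rho> assume r: "\<rho> \<in> perms srt" and fx: "\<forall>a\<in>Perm.apply \<pi> ` N. Perm.apply \<rho> a = a"
  let ?c = "inverse \<pi> * (\<rho> * \<pi>)"
  have c: "?c \<in> perms srt" by (intro perms_times perms_inverse p r)
  have "act X ?c x = x"
    using s c fx unfolding supports_def by (auto simp: apply_times)
  then have "act X \<pi> x = act X (\<pi> * ?c) x"
    using nominal_setD(3)[OF X p c x] by simp
  also have "\<pi> * ?c = \<rho> * \<pi>" by (rule perm_eqI) (simp add: apply_times)
  also have "act X (\<rho> * \<pi>) x = act X \<rho> (act X \<pi> x)" by (rule nominal_setD(3)[OF X r p x])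
  finally show "act X \<rho> (act X \<pi> x) = act X \<pi> x" by simp
qed

lemma supp_act_subset:
  assumes X: "nominal_set srt X" and p: "\<pi> \<in> perms srt" and x: "x \<in> carrier X"
  shows "supp srt X (act X \<pi> x) \<subseteq> Perm.apply \<pi> ` supp srt X x"
proof
  fix b assume b: "b \<in> supp srt X (act X \<pi> x)"
  have "Perm.apply (inverse \<pi>) b \<in> supp srt X x"
    unfolding supp_def
  proof safe
    fix N assume "finite N" "supports srt X N x"
    then have "b \<in> Perm.apply \<pi> ` N"
      using b supports_act[OF X p x] unfolding supp_def by blast
    then show "Perm.apply (inverse \<pi>) b \<in> N" by auto
  qed
  then show "b \<in> Perm.apply \<pi> ` supp srt X x"
    by (metis apply_inverse_right image_eqI)
qed

lemma supp_act:
  assumes X: "nominal_set srt X" and p: "\<pi> \<in> perms srt" and x: "x \<in> carrier X"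
  shows "supp srt X (act X \<pi> x) = Perm.apply \<pi> ` supp srt X x"
proof
  have "supp srt X x \<subseteq> Perm.apply (inverse \<pi>) ` supp srt X (act X \<pi> x)"
    using supp_act_subset[OF X perms_inverse[OF p] nominal_setD(1)[OF X p x]]
    by (simp add: act_inverse_left[OF X p x])
  then show "Perm.apply \<pi> ` supp srt X x \<subseteq> supp srt X (act X \<pi> x)"
    by force
qed (rule supp_act_subset[OF X p x])

lemma fresh_renaming:
  assumes srt: "name_sorting srt" and "finite B" and A: "finite A"
  shows "\<exists>\<rho>\<in>perms srt. Perm.apply \<rho> ` B \<inter> A = {} \<and> (\<forall>a\<in>A - B. Perm.apply \<rho> a = a)"
  using \<open>finite B\<close>
proof induction
  case empty
  show ?case by (intro bexI[OF _ perms_one]) simp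
next
  case (insert b B)
  then obtain \<rho> where r: "\<rho> \<in> perms srt" "Perm.apply \<rho> ` B \<inter> A = {}"
    "\<forall>a\<in>A - B. Perm.apply \<rho> a = a" by blast
  have "infinite ({c. srt c = srt b} - (A \<union> Perm.apply \<rho> ` B))"
    using srt A insert.hyps(1) by (intro Diff_infinite_finite) (auto simp: name_sorting_def)
  then obtain c where c: "srt c = srt b" "c \<notin> A" "c \<notin> Perm.apply \<rho> ` B"
    using infinite_imp_nonempty by blast
  let ?s = "Perm.swap (Perm.apply \<rho> b) c"
  have sw: "Perm.apply ?s d = (if d = Perm.apply \<rho> b then c else if d = c then Perm.apply \<rho> b else d)" for d
    by simp
  have "?s \<in> perms srt"
    using r(1) c(1) by (auto simp: perms_def sw)
  then have "?s * \<rho> \<in> perms srt" by (rule perms_times[OF _ r(1)])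
  moreover have "Perm.apply (?s * \<rho>) ` insert b B \<inter> A = {}"
  proof -
    have "Perm.apply (?s * \<rho>) d \<notin> A" if "d \<in> insert b B" for d
      using that r(2) c insert.hyps(2) by (auto simp: apply_times sw apply_inj)
    then show ?thesis by blast
  qed
  moreover have "Perm.apply (?s * \<rho>) a = a" if a: "a \<in> A - insert b B" for a
  proof -
    have ra: "Perm.apply \<rho> a = a" using a r(3) by blast
    then have "a \<noteq> Perm.apply \<rho> b" using a by (metis DiffE apply_inj insertI1)
    then show ?thesis using a c(2) ra by (auto simp: apply_times sw)
  qed
  ultimately show ?case by blast
qed

lemma supports_Int:
  assumes srt: "name_sorting srt" and X: "nominal_set srt X" and x: "x \<in> carrier X"
    and N: "finite N" "supports srt X N x" and M: "finite M" "supports srt X M x"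
  shows "supports srt X (N \<inter> M) x"
  unfolding supports_def
proof (intro ballI impI)
  fix \<pi> assume p: "\<pi> \<in> perms srt" and fx: "\<forall>a\<in>N \<inter> M. Perm.apply \<pi> a = a"
  obtain \<rho> where r: "\<rho> \<in> perms srt" "Perm.apply \<rho> ` (M - N) \<inter> (N \<union> M \<union> affected \<pi>) = {}"
    "\<forall>a\<in>(N \<union> M \<union> affected \<pi>) - (M - N). Perm.apply \<rho> a = a"
    using fresh_renaming[OF srt, of "M - N" "N \<union> M \<union> affected \<pi>"] N(1) M(1) by auto
  have "act X \<rho> x = x" using N(2) r(1,3) unfolding supports_def by auto
  then have "supports srt X (Perm.apply \<rho> ` M) x"
    using supports_act[OF X r(1) x M(2)] by simp
  moreover have "Perm.apply \<pi> b = b" if "b \<in> Perm.apply \<rho> ` M" for b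
  proof -
    obtain a where a: "a \<in> M" "b = Perm.apply \<rho> a" using \<open>b \<in> Perm.apply \<rho> ` M\<close> by blast
    show ?thesis
    proof (cases "a \<in> N")
      case True
      then have "b = a" using a r(3) by auto
      then show ?thesis using True a fx by auto
    next
      case False
      then have "b \<notin> affected \<pi>" using a r(2) by blast
      then show ?thesis by (simp add: in_affected)
    qed
  qed
  ultimately show "act X \<pi> x = x" using p unfolding supports_def by blast
qed

lemma supp_supports:
  assumes srt: "name_sorting srt" and X: "nominal_set srt X" and x: "x \<in> carrier X"
  shows "finite (supp srt X x)" and "supports srt X (supp srt X x) x"
proof -
  obtain M where M: "finite M" "supports srt X M x"
    and min: "\<And>N. finite N \<Longrightarrow> supports srt X N x \<Longrightarrow> card M \<le> card N"
    using ex_has_least_nat[of "\<lambda>N. finite N \<and> supports srt X N x" _ card] nominal_setD(4)[OF X x]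
    by metis
  have "M \<subseteq> N" if N: "finite N" "supports srt X N x" for N
  proof -
    have "card M \<le> card (M \<inter> N)"
      using min[OF _ supports_Int[OF srt X x M N]] M(1) by blast
    then show ?thesis using M(1) by (metis card_seteq inf_le1 inf_le2)
  qed
  then have "supp srt X x = M" using M unfolding supp_def by blast
  with M show "finite (supp srt X x)" and "supports srt X (supp srt X x) x" by auto
qed

lemma alpha_relI:
  assumes "finite N" "x \<in> carrier X" "nominal_set srt X" "\<pi> \<in> perms srt"
    "\<And>a. a \<in> supp srt X x - N \<Longrightarrow> Perm.apply \<pi> a = a"
  shows "((N, x), (Perm.apply \<pi> ` N, act X \<pi> x)) \<in> alpha_rel srt X"
  using assms nominal_setD(1)[of srt X \<pi> x]
  unfolding alpha_rel_def prod_permset_def fin_names_def by auto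

lemma alpha_relE:
  assumes "((N, x), (N', x')) \<in> alpha_rel srt X"
  obtains \<pi> where "finite N" "x \<in> carrier X" "finite N'" "x' \<in> carrier X" "\<pi> \<in> perms srt"
    "N' = Perm.apply \<pi> ` N" "x' = act X \<pi> x"
    "\<And>a. a \<in> supp srt X x - N \<Longrightarrow> Perm.apply \<pi> a = a"
  using assms unfolding alpha_rel_def prod_permset_def fin_names_def by auto

lemma equiv_alpha_rel:
  assumes X: "nominal_set srt X"
  shows "equiv (carrier (prod_permset fin_names X)) (alpha_rel srt X)"
proof (rule equivI)
  show "alpha_rel srt X \<subseteq> carrier (prod_permset fin_names X) \<times> carrier (prod_permset fin_names X)"
    unfolding alpha_rel_def by auto
  show "refl_on (carrier (prod_permset fin_names X)) (alpha_rel srt X)"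
  proof (rule refl_onI)
    fix y assume "y \<in> carrier (prod_permset fin_names X)"
    then obtain N x where y: "y = (N, x)" "finite N" "x \<in> carrier X"
      by (auto simp: prod_permset_def fin_names_def)
    show "(y, y) \<in> alpha_rel srt X"
      using alpha_relI[OF y(2,3) X perms_one] y nominal_setD(2)[OF X y(3)] by simp
  qed
  show "sym (alpha_rel srt X)"
  proof (rule symI)
    fix y y' assume yy: "(y, y') \<in> alpha_rel srt X"
    obtain N x N' x' where y: "y = (N, x)" "y' = (N', x')" by fastforce
    from yy[unfolded y] show "(y', y) \<in> alpha_rel srt X"
    proof (cases rule: alpha_relE)
      case (1 \<pi>)
      have "((N', x'), (Perm.apply (inverse \<pi>) ` N', act X (inverse \<pi>) x')) \<in> alpha_rel srt X"
      proof (rule alpha_relI[OF 1(3,4) X perms_inverse[OF 1(5)]])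
        fix a assume "a \<in> supp srt X x' - N'"
        then obtain b where "b \<in> supp srt X x - N" "a = Perm.apply \<pi> b"
          using supp_act[OF X 1(5,2)] 1(6,7) by auto
        then show "Perm.apply (inverse \<pi>) a = a" using 1(8)[of b] by (metis apply_inverse_left)
      qed
      moreover have "Perm.apply (inverse \<pi>) ` N' = N"
        unfolding 1(6) by (simp add: image_image)
      moreover have "act X (inverse \<pi>) x' = x"
        unfolding 1(7) by (rule act_inverse_left[OF X 1(5,2)])
      ultimately show ?thesis by (simp add: y)
    qed
  qed
  show "Relation.trans (alpha_rel srt X)"
  proof (rule transI)
    fix y y' y'' assume yy: "(y, y') \<in> alpha_rel srt X" "(y', y'') \<in> alpha_rel srt X"
    obtain N x N' x' N'' x'' where y: "y = (N, x)" "y' = (N', x')" "y'' = (N'', x'')" by (metis prod.exhaust)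
    from yy(1)[unfolded y] show "(y, y'') \<in> alpha_rel srt X"
    proof (cases rule: alpha_relE)
      case (1 \<pi>)
      from yy(2)[unfolded y] obtain \<rho> where r: "\<rho> \<in> perms srt" "N'' = Perm.apply \<rho> ` N'"
        "x'' = act X \<rho> x'" "\<And>a. a \<in> supp srt X x' - N' \<Longrightarrow> Perm.apply \<rho> a = a"
        by (rule alpha_relE) blast
      have "((N, x), (Perm.apply (\<rho> * \<pi>) ` N, act X (\<rho> * \<pi>) x)) \<in> alpha_rel srt X"
      proof (rule alpha_relI[OF 1(1,2) X perms_times[OF r(1) 1(5)]])
        fix a assume a: "a \<in> supp srt X x - N"
        have "a \<in> supp srt X x' - N'"
          using a 1(8)[OF a] supp_act[OF X 1(5,2)] unfolding 1(6,7)
          by (auto simp: image_iff) (metis apply_inverse_left)+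
        then show "Perm.apply (\<rho> * \<pi>) a = a" using r(4) 1(8)[OF a] by (simp add: apply_times)
      qed
      then show ?thesis
        using nominal_setD(3)[OF X r(1) 1(5,2)] by (simp add: y r 1(6,7) image_image apply_times)
    qed
  qed
qed

lemma alpha_rel_act:
  assumes X: "nominal_set srt X" and s: "\<sigma> \<in> perms srt"
    and rel: "((N, x), (N', x')) \<in> alpha_rel srt X"
  shows "((Perm.apply \<sigma> ` N, act X \<sigma> x), (Perm.apply \<sigma> ` N', act X \<sigma> x')) \<in> alpha_rel srt X"
  using rel
proof (cases rule: alpha_relE)
  case (1 \<pi>)
  let ?c = "\<sigma> * (\<pi> * inverse \<sigma>)"
  have c: "?c \<in> perms srt" by (intro perms_times perms_inverse s 1(5))
  have "((Perm.apply \<sigma> ` N, act X \<sigma> x),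
         (Perm.apply ?c ` (Perm.apply \<sigma> ` N), act X ?c (act X \<sigma> x))) \<in> alpha_rel srt X"
  proof (rule alpha_relI[OF _ nominal_setD(1)[OF X s 1(2)] X c])
    fix a assume "a \<in> supp srt X (act X \<sigma> x) - Perm.apply \<sigma> ` N"
    then obtain b where "b \<in> supp srt X x - N" "a = Perm.apply \<sigma> b"
      using supp_act[OF X s 1(2)] by auto
    then show "Perm.apply ?c a = a" using 1(8)[of b] by (simp add: apply_times)
  qed (simp add: 1(1))
  moreover have "act X ?c (act X \<sigma> x) = act X \<sigma> x'"
  proof -
    have "act X ?c (act X \<sigma> x) = act X (?c * \<sigma>) x"
      by (rule nominal_setD(3)[OF X c s 1(2), symmetric])
    also have "?c * \<sigma> = \<sigma> * \<pi>" by (rule perm_eqI) (simp add: apply_times)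
    also have "act X (\<sigma> * \<pi>) x = act X \<sigma> x'"
      unfolding 1(7) by (rule nominal_setD(3)[OF X s 1(5,2)])
    finally show ?thesis .
  qed
  ultimately show ?thesis by (simp add: 1(6) image_image apply_times)
qed

lemma abstr_eq_iff:
  assumes X: "nominal_set srt X" and "finite N" "x \<in> carrier X" "finite N'" "x' \<in> carrier X"
  shows "abstr srt X N x = abstr srt X N' x' \<longleftrightarrow> ((N, x), (N', x')) \<in> alpha_rel srt X"
  unfolding abstr_def using assms
  by (intro eq_equiv_class_iff[OF equiv_alpha_rel[OF X]]) (auto simp: prod_permset_def fin_names_def)

lemma act_abstr:
  assumes X: "nominal_set srt X" and s: "\<sigma> \<in> perms srt" and x: "x \<in> carrier X"
  shows "act (abstr_permset srt X) \<sigma> (abstr srt X N x) = abstr srt X (Perm.apply \<sigma> ` N) (act X \<sigma> x)"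
proof -
  have "act (prod_permset fin_names X) \<sigma> ` abstr srt X N x = abstr srt X (Perm.apply \<sigma> ` N) (act X \<sigma> x)"
  proof (rule set_eqI, rule iffI)
    fix z assume "z \<in> act (prod_permset fin_names X) \<sigma> ` abstr srt X N x"
    then obtain M y where "(M, y) \<in> abstr srt X N x" and z: "z = act (prod_permset fin_names X) \<sigma> (M, y)"
      by auto
    then show "z \<in> abstr srt X (Perm.apply \<sigma> ` N) (act X \<sigma> x)"
      unfolding z
      using alpha_rel_act[OF X s] by (auto simp: abstr_def prod_permset_def fin_names_def)
  next
    fix z assume z: "z \<in> abstr srt X (Perm.apply \<sigma> ` N) (act X \<sigma> x)"
    obtain M y where zz: "z = (M, y)" by (cases z)
    have rel: "((Perm.apply \<sigma> ` N, act X \<sigma> x), (M, y)) \<in> alpha_rel srt X"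
      using z by (simp add: abstr_def zz)
    then have y: "y \<in> carrier X" by (rule alpha_relE)
    have "((N, x), (Perm.apply (inverse \<sigma>) ` M, act X (inverse \<sigma>) y)) \<in> alpha_rel srt X"
      using alpha_rel_act[OF X perms_inverse[OF s] rel] act_inverse_left[OF X s x]
      by (simp add: image_image)
    moreover have "act X \<sigma> (act X (inverse \<sigma>) y) = y"
      using nominal_setD(3)[OF X s perms_inverse[OF s] y] nominal_setD(2)[OF X y]
      by (simp add: inverse_perm_right)
    ultimately show "z \<in> act (prod_permset fin_names X) \<sigma> ` abstr srt X N x"
      by (intro image_eqI[of _ _ "(Perm.apply (inverse \<sigma>) ` M, act X (inverse \<sigma>) y)"])
        (auto simp: zz abstr_def prod_permset_def fin_names_def image_image)
  qed
  then show ?thesis by (simp add: abstr_permset_def)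
qed

lemma prod_permset_simps:
  "act (prod_permset X Y) \<pi> (x, y) = (act X \<pi> x, act Y \<pi> y)"
  "(x, y) \<in> carrier (prod_permset X Y) \<longleftrightarrow> x \<in> carrier X \<and> y \<in> carrier Y"
  by (simp_all add: prod_permset_def)

lemma nominal_set_prod:
  assumes X: "nominal_set srt X" and Y: "nominal_set srt Y"
  shows "nominal_set srt (prod_permset X Y)"
proof -
  have "\<exists>N. finite N \<and> supports srt (prod_permset X Y) N (x, y)"
    if xy: "x \<in> carrier X" "y \<in> carrier Y" for x y
  proof -
    obtain N M where "finite N" "supports srt X N x" "finite M" "supports srt Y M y"
      using nominal_setD(4)[OF X xy(1)] nominal_setD(4)[OF Y xy(2)] by blast
    then show ?thesis
      by (intro exI[of _ "N \<union> M"]) (simp add: supports_def prod_permset_def)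
  qed
  then show ?thesis
    using nominal_setD(1-3)[OF X] nominal_setD(1-3)[OF Y]
    unfolding nominal_set_def by (auto simp: prod_permset_def)
qed

lemma nominal_set_sum:
  assumes X: "nominal_set srt X" and Y: "nominal_set srt Y"
  shows "nominal_set srt (sum_permset X Y)"
proof -
  have "supports srt (sum_permset X Y) N (Inl x) \<longleftrightarrow> supports srt X N x"
    "supports srt (sum_permset X Y) N (Inr y) \<longleftrightarrow> supports srt Y N y" for N x y
    by (auto simp: supports_def sum_permset_def)
  then show ?thesis
    using nominal_setD[OF X] nominal_setD[OF Y]
    unfolding nominal_set_def by (auto simp: sum_permset_def)
qed

lemma supp_Inl: "supp srt (sum_permset X Y) (Inl x) = supp srt X x"
  by (simp add: supp_def supports_def sum_permset_def)

lemma supp_Pair_Inl: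
  "supp srt (prod_permset (sum_permset X Y) Z) (Inl x, z) = supp srt (prod_permset X Z) (x, z)"
  by (simp add: supp_def supports_def sum_permset_def prod_permset_def)

lemma alpha_rel_Inl_iff:
  "((N, (Inl x, z)), (N', (Inl x', z'))) \<in> alpha_rel srt (prod_permset (sum_permset X Y) Z) \<longleftrightarrow>
   ((N, (x, z)), (N', (x', z'))) \<in> alpha_rel srt (prod_permset X Z)"
  unfolding alpha_rel_def
  by (simp add: supp_Pair_Inl) (auto simp: sum_permset_def prod_permset_def fin_names_def)

lemma alpha_rel_Inr_Inl:
  "((N, (Inr y, z)), (N', (Inl x', z'))) \<notin> alpha_rel srt (prod_permset (sum_permset X Y) Z)"
  "((N, (Inl x, z)), (N', (Inr y', z'))) \<notin> alpha_rel srt (prod_permset (sum_permset X Y) Z)"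
  unfolding alpha_rel_def
  by (auto simp: sum_permset_def prod_permset_def fin_names_def)

lemma preds_to_acts_simps [simp]:
  "states (preds_to_acts srt T) = states T"
  "preds (preds_to_acts srt T) = \<lparr>carrier = {}, act = act (preds T)\<rparr>"
  "acts (preds_to_acts srt T) = sum_permset (acts T) (preds T)"
  "sat (preds_to_acts srt T) = {}"
  "bn (preds_to_acts srt T) = case_sum (bn T) (\<lambda>_. {})"
  by (simp_all add: preds_to_acts_def Let_def)

lemma transitions_preds_to_acts:
  "transitions (preds_to_acts srt T) =
     {(P, abstr srt (residuals (preds_to_acts srt T)) (bn T \<alpha>) (Inl \<alpha>, P')) | P \<alpha> P'. step srt T P \<alpha> P'} \<union>
     {(P, abstr srt (residuals (preds_to_acts srt T)) {} (Inr \<phi>, P)) | P \<phi>. (P, \<phi>) \<in> sat T}"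
  unfolding preds_to_acts_simps by (simp add: preds_to_acts_def Let_def)

context
  fixes srt :: "'n \<Rightarrow> 's" and T :: "('n, 'st, 'pr, 'ac) nts"
  assumes srt: "name_sorting srt" and nts: "nominal_transition_system srt T"
begin

lemma nts_nominal:
  "nominal_set srt (states T)" "nominal_set srt (preds T)" "nominal_set srt (acts T)"
  "nominal_set srt (residuals T)" "nominal_set srt (residuals (preds_to_acts srt T))"
  using nts by (auto simp: nominal_transition_system_def intro!: nominal_set_prod nominal_set_sum)

lemma nts_bn:
  "\<alpha> \<in> carrier (acts T) \<Longrightarrow> finite (bn T \<alpha>)"
  "\<alpha> \<in> carrier (acts T) \<Longrightarrow> bn T \<alpha> \<subseteq> supp srt (acts T) \<alpha>"
  "\<pi> \<in> perms srt \<Longrightarrow> \<alpha> \<in> carrier (acts T) \<Longrightarrow> bn T (act (acts T) \<pi> \<alpha>) = Perm.apply \<pi> ` bn T \<alpha>"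
  using nts unfolding nominal_transition_system_def by auto

lemma nts_step_carrier: "step srt T P \<alpha> P' \<Longrightarrow> P \<in> carrier (states T)"
  using nts unfolding nominal_transition_system_def step_def by auto

lemma nts_sat_carrier: "(P, \<phi>) \<in> sat T \<Longrightarrow> P \<in> carrier (states T) \<and> \<phi> \<in> carrier (preds T)"
  using nts unfolding nominal_transition_system_def by auto

lemma in_transitions_Inl_iff:
  assumes "finite N" "\<alpha> \<in> carrier (acts T)" "P' \<in> carrier (states T)"
  shows "(P, abstr srt (residuals (preds_to_acts srt T)) N (Inl \<alpha>, P')) \<in> transitions (preds_to_acts srt T)
    \<longleftrightarrow> N = bn T \<alpha> \<and> step srt T P \<alpha> P'"
proof
  let ?X = "residuals (preds_to_acts srt T)"
  assume "(P, abstr srt ?X N (Inl \<alpha>, P')) \<in> transitions (preds_to_acts srt T)"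
  then consider
      (1) \<beta> Q where "abstr srt ?X N (Inl \<alpha>, P') = abstr srt ?X (bn T \<beta>) (Inl \<beta>, Q)" "step srt T P \<beta> Q"
    | (2) \<phi> where "abstr srt ?X N (Inl \<alpha>, P') = abstr srt ?X {} (Inr \<phi>, P)" "(P, \<phi>) \<in> sat T"
    unfolding transitions_preds_to_acts by blast
  then show "N = bn T \<alpha> \<and> step srt T P \<alpha> P'"
  proof cases
    case 1
    have c: "\<beta> \<in> carrier (acts T)" "Q \<in> carrier (states T)"
      using 1(2) by (auto simp: step_def)
    have "((N, (Inl \<alpha>, P')), (bn T \<beta>, (Inl \<beta>, Q))) \<in> alpha_rel srt ?X"
      using 1(1) assms c nts_bn(1)[OF c(1)]
      by (subst (asm) abstr_eq_iff[OF nts_nominal(5)]) (auto simp: prod_permset_def sum_permset_def)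
    then have "((N, (\<alpha>, P')), (bn T \<beta>, (\<beta>, Q))) \<in> alpha_rel srt (residuals T)"
      by (simp add: alpha_rel_Inl_iff)
    then have "abstr srt (residuals T) N (\<alpha>, P') = abstr srt (residuals T) (bn T \<beta>) (\<beta>, Q)"
      using assms c nts_bn(1)[OF c(1)]
      by (subst abstr_eq_iff[OF nts_nominal(4)]) (auto simp: prod_permset_def)
    then have t: "(P, abstr srt (residuals T) N (\<alpha>, P')) \<in> transitions T"
      using 1(2) by (simp add: step_def)
    then have "N = bn T \<alpha>"
      using nts assms unfolding nominal_transition_system_def by blast
    with t assms show ?thesis by (simp add: step_def)
  next
    case 2
    have "((N, (Inl \<alpha>, P')), ({}, (Inr \<phi>, P))) \<in> alpha_rel srt ?X"
      using 2 assms nts_sat_carrier[OF 2(2)]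
      by (subst (asm) abstr_eq_iff[OF nts_nominal(5)]) (auto simp: prod_permset_def sum_permset_def)
    then show ?thesis by (simp add: alpha_rel_Inr_Inl)
  qed
next
  assume "N = bn T \<alpha> \<and> step srt T P \<alpha> P'"
  then show "(P, abstr srt (residuals (preds_to_acts srt T)) N (Inl \<alpha>, P')) \<in> transitions (preds_to_acts srt T)"
    unfolding transitions_preds_to_acts by blast
qed

lemma in_transitions_Inr_iff:
  assumes "finite N" "\<phi> \<in> carrier (preds T)" "P' \<in> carrier (states T)"
  shows "(P, abstr srt (residuals (preds_to_acts srt T)) N (Inr \<phi>, P')) \<in> transitions (preds_to_acts srt T)
    \<longleftrightarrow> N = {} \<and> P' = P \<and> (P, \<phi>) \<in> sat T"
proof
  let ?X = "residuals (preds_to_acts srt T)"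
  assume "(P, abstr srt ?X N (Inr \<phi>, P')) \<in> transitions (preds_to_acts srt T)"
  then consider
      (1) \<beta> Q where "abstr srt ?X N (Inr \<phi>, P') = abstr srt ?X (bn T \<beta>) (Inl \<beta>, Q)" "step srt T P \<beta> Q"
    | (2) \<psi> where "abstr srt ?X N (Inr \<phi>, P') = abstr srt ?X {} (Inr \<psi>, P)" "(P, \<psi>) \<in> sat T"
    unfolding transitions_preds_to_acts by blast
  then show "N = {} \<and> P' = P \<and> (P, \<phi>) \<in> sat T"
  proof cases
    case 1
    have c: "\<beta> \<in> carrier (acts T)" "Q \<in> carrier (states T)"
      using 1(2) by (auto simp: step_def)
    have "((N, (Inr \<phi>, P')), (bn T \<beta>, (Inl \<beta>, Q))) \<in> alpha_rel srt ?X"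
      using 1(1) assms c nts_bn(1)[OF c(1)]
      by (subst (asm) abstr_eq_iff[OF nts_nominal(5)]) (auto simp: prod_permset_def sum_permset_def)
    then show ?thesis by (simp add: alpha_rel_Inr_Inl)
  next
    case 2
    have "((N, (Inr \<phi>, P')), ({}, (Inr \<psi>, P))) \<in> alpha_rel srt ?X"
      using 2 assms nts_sat_carrier[OF 2(2)]
      by (subst (asm) abstr_eq_iff[OF nts_nominal(5)]) (auto simp: prod_permset_def sum_permset_def)
    then obtain \<pi> where p: "\<pi> \<in> perms srt" "N = {}"
      "(Inr \<psi>, P) = act ?X \<pi> (Inr \<phi>, P')"
      "\<And>a. a \<in> supp srt ?X (Inr \<phi>, P') \<Longrightarrow> Perm.apply \<pi> a = a"
      by (rule alpha_relE) auto
    have "(Inr \<phi>, P') \<in> carrier ?X"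
      using assms by (auto simp: prod_permset_def sum_permset_def)
    then have "act ?X \<pi> (Inr \<phi>, P') = (Inr \<phi>, P')"
      using supp_supports(2)[OF srt nts_nominal(5)] p(1,4) unfolding supports_def by blast
    then show ?thesis using p(2,3) 2(2) by simp
  qed
next
  assume "N = {} \<and> P' = P \<and> (P, \<phi>) \<in> sat T"
  then show "(P, abstr srt (residuals (preds_to_acts srt T)) N (Inr \<phi>, P')) \<in> transitions (preds_to_acts srt T)"
    unfolding transitions_preds_to_acts by blast
qed

lemma step_preds_to_acts_Inl:
  "step srt (preds_to_acts srt T) P (Inl \<alpha>) P' \<longleftrightarrow> step srt T P \<alpha> P'"
proof (cases "\<alpha> \<in> carrier (acts T) \<and> P' \<in> carrier (states T)")
  case True
  then show ?thesis
    using in_transitions_Inl_iff[OF nts_bn(1), of \<alpha> \<alpha> P' P]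
    by (simp add: step_def[of srt "preds_to_acts srt T"] sum_permset_def[of "acts T"] InlI)
next
  case False
  then show ?thesis by (auto simp: step_def sum_permset_def)
qed

lemma step_preds_to_acts_Inr:
  "step srt (preds_to_acts srt T) P (Inr \<phi>) P' \<longleftrightarrow> P' = P \<and> (P, \<phi>) \<in> sat T"
proof (cases "\<phi> \<in> carrier (preds T) \<and> P' \<in> carrier (states T)")
  case True
  then have "Inr \<phi> \<in> carrier (sum_permset (acts T) (preds T))" by (simp add: sum_permset_def InrI)
  with True show ?thesis
    using in_transitions_Inr_iff[of "{}" \<phi> P' P]
    by (simp add: step_def)
next
  case False
  then show ?thesis using nts_sat_carrier by (auto simp: step_def sum_permset_def)
qed

lemma step_act:
  assumes s: "step srt T P \<alpha> P'" and p: "\<pi> \<in> perms srt"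
  shows "step srt T (act (states T) \<pi> P) (act (acts T) \<pi> \<alpha>) (act (states T) \<pi> P')"
proof -
  have c: "\<alpha> \<in> carrier (acts T)" "P' \<in> carrier (states T)" "(\<alpha>, P') \<in> carrier (residuals T)"
    using s by (auto simp: step_def prod_permset_def)
  have "(act (states T) \<pi> P, act (abstr_permset srt (residuals T)) \<pi>
      (abstr srt (residuals T) (bn T \<alpha>) (\<alpha>, P'))) \<in> transitions T"
  proof -
    have "equivariant srt (prod_permset (states T) (abstr_permset srt (residuals T))) (transitions T)"
      using nts unfolding nominal_transition_system_def by blast
    then have "act (prod_permset (states T) (abstr_permset srt (residuals T))) \<pi>
        (P, abstr srt (residuals T) (bn T \<alpha>) (\<alpha>, P')) \<in> transitions T"
      using s p unfolding equivariant_def step_def by blast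
    then show ?thesis by (simp add: prod_permset_simps)
  qed
  moreover have "act (residuals T) \<pi> (\<alpha>, P') = (act (acts T) \<pi> \<alpha>, act (states T) \<pi> P')"
    by (simp add: prod_permset_def)
  ultimately show ?thesis
    using nominal_setD(1)[OF nts_nominal(1) p c(2)] nominal_setD(1)[OF nts_nominal(3) p c(1)]
    by (simp add: act_abstr[OF nts_nominal(4) p c(3)] nts_bn(3)[OF p c(1)] step_def)
qed

lemma sat_act:
  assumes "(P, \<phi>) \<in> sat T" and "\<pi> \<in> perms srt"
  shows "(act (states T) \<pi> P, act (preds T) \<pi> \<phi>) \<in> sat T"
proof -
  have "equivariant srt (prod_permset (states T) (preds T)) (sat T)"
    using nts unfolding nominal_transition_system_def by blast
  then have "act (prod_permset (states T) (preds T)) \<pi> (P, \<phi>) \<in> sat T"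
    using assms unfolding equivariant_def by blast
  then show ?thesis by (simp add: prod_permset_simps)
qed

theorem nominal_transition_system_preds_to_acts:
  "nominal_transition_system srt (preds_to_acts srt T)"
proof -
  let ?S = "preds_to_acts srt T"
  let ?X = "residuals ?S"
  have cI: "(Inl \<alpha>, P') \<in> carrier ?X" if "\<alpha> \<in> carrier (acts T)" "P' \<in> carrier (states T)" for \<alpha> P'
    using that by (auto simp: prod_permset_def sum_permset_def)
  have cR: "(Inr \<phi>, P') \<in> carrier ?X" if "\<phi> \<in> carrier (preds T)" "P' \<in> carrier (states T)" for \<phi> P'
    using that by (auto simp: prod_permset_def sum_permset_def)
  have cA: "abstr srt ?X N y \<in> carrier (abstr_permset srt ?X)" if "finite N" "y \<in> carrier ?X" for N y
    using that unfolding abstr_permset_def abstr_def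
    by (auto intro!: quotientI simp: prod_permset_simps) (simp add: fin_names_def)
  have "transitions ?S \<subseteq> carrier (states T) \<times> carrier (abstr_permset srt ?X)"
  proof
    fix t assume "t \<in> transitions ?S"
    then consider
        (1) P \<alpha> P' where "t = (P, abstr srt ?X (bn T \<alpha>) (Inl \<alpha>, P'))" "step srt T P \<alpha> P'"
      | (2) P \<phi> where "t = (P, abstr srt ?X {} (Inr \<phi>, P))" "(P, \<phi>) \<in> sat T"
      unfolding transitions_preds_to_acts by blast
    then show "t \<in> carrier (states T) \<times> carrier (abstr_permset srt ?X)"
    proof cases
      case 1
      then have c: "\<alpha> \<in> carrier (acts T)" "P' \<in> carrier (states T)" by (auto simp: step_def)
      show ?thesis
        using cA[OF nts_bn(1)[OF c(1)] cI[OF c]] nts_step_carrier[OF 1(2)] 1(1) by blast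
    next
      case 2
      then show ?thesis using cA[of "{}"] cR nts_sat_carrier[OF 2(2)] by blast
    qed
  qed
  moreover have "equivariant srt (prod_permset (states T) (abstr_permset srt ?X)) (transitions ?S)"
    unfolding equivariant_def
  proof (intro ballI)
    fix \<pi> t assume p: "\<pi> \<in> perms srt" and "t \<in> transitions ?S"
    then consider
        (1) P \<alpha> P' where "t = (P, abstr srt ?X (bn T \<alpha>) (Inl \<alpha>, P'))" "step srt T P \<alpha> P'"
      | (2) P \<phi> where "t = (P, abstr srt ?X {} (Inr \<phi>, P))" "(P, \<phi>) \<in> sat T"
      unfolding transitions_preds_to_acts by blast
    then show "act (prod_permset (states T) (abstr_permset srt ?X)) \<pi> t \<in> transitions ?S"
    proof cases
      case 1
      then have c: "\<alpha> \<in> carrier (acts T)" "P' \<in> carrier (states T)" by (auto simp: step_def)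
      have "act (prod_permset (states T) (abstr_permset srt ?X)) \<pi> t =
          (act (states T) \<pi> P, abstr srt ?X (bn T (act (acts T) \<pi> \<alpha>))
            (Inl (act (acts T) \<pi> \<alpha>), act (states T) \<pi> P'))"
        using act_abstr[OF nts_nominal(5) p cI[OF c]] nts_bn(3)[OF p c(1)] 1(1)
        by (simp add: prod_permset_def sum_permset_def)
      then show ?thesis
        unfolding transitions_preds_to_acts using step_act[OF 1(2) p] by blast
    next
      case 2
      have "act (prod_permset (states T) (abstr_permset srt ?X)) \<pi> t =
          (act (states T) \<pi> P, abstr srt ?X {} (Inr (act (preds T) \<pi> \<phi>), act (states T) \<pi> P))"
        using act_abstr[OF nts_nominal(5) p cR, of \<phi> P "{}"] nts_sat_carrier[OF 2(2)] 2(1)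
        by (simp add: prod_permset_def sum_permset_def)
      then show ?thesis
        unfolding transitions_preds_to_acts using sat_act[OF 2(2) p] by blast
    qed
  qed
  moreover have "N = bn ?S \<alpha>"
    if "finite N" "\<alpha> \<in> carrier (acts ?S)" "Q \<in> carrier (states T)"
      "(P, abstr srt ?X N (\<alpha>, Q)) \<in> transitions ?S" for P N \<alpha> Q
  proof (cases \<alpha>)
    case (Inl \<beta>)
    then have "\<beta> \<in> carrier (acts T)" using that(2) by (auto simp: sum_permset_def)
    then show ?thesis using in_transitions_Inl_iff[OF that(1) _ that(3)] that(4) Inl by simp
  next
    case (Inr \<phi>)
    then have "\<phi> \<in> carrier (preds T)" using that(2) by (auto simp: sum_permset_def)
    then show ?thesis using in_transitions_Inr_iff[OF that(1) _ that(3)] that(4) Inr by simp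
  qed
  moreover have "nominal_set srt (preds ?S)"
    by (simp add: nominal_set_def)
  moreover have "equivariant srt (prod_permset (states T) (preds ?S)) (sat ?S)"
    by (simp add: equivariant_def)
  moreover have "bn ?S (act (acts ?S) \<pi> \<alpha>) = Perm.apply \<pi> ` bn ?S \<alpha>"
    if "\<pi> \<in> perms srt" "\<alpha> \<in> carrier (acts ?S)" for \<pi> \<alpha>
    using that nts_bn(3) by (auto simp: sum_permset_def)
  moreover have "finite (bn ?S \<alpha>) \<and> bn ?S \<alpha> \<subseteq> supp srt (acts ?S) \<alpha>" if "\<alpha> \<in> carrier (acts ?S)" for \<alpha>
  proof (cases \<alpha>)
    case (Inl \<beta>)
    then have "\<beta> \<in> carrier (acts T)" using that by (auto simp: sum_permset_def)
    then show ?thesis using nts_bn(1,2) Inl by (simp add: supp_Inl)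
  qed simp
  ultimately show ?thesis
    using nts_nominal(1,2,3) nominal_set_sum[OF nts_nominal(3,2)]
    unfolding nominal_transition_system_def by simp
qed

end

end

theory Submission
  imports Defs
begin

text \<open>
  Weak bisimilarity of \<open>\<S>(T)\<close> is itself a weak bisimulation of \<open>T\<close>. Only static implication is
  not immediate: if \<open>P\<close> satisfies \<open>\<phi>\<close>, the transition \<open>P \<rightarrow> P\<close> labelled \<open>\<phi>\<close> is matched by
  \<open>Q \<Rightarrow> Q\<^sub>1 \<Rightarrow> Q'\<close> where \<open>Q\<^sub>1\<close> satisfies \<open>\<phi>\<close>, but only \<open>P \<approx> Q'\<close> is given. Since also \<open>P \<approx> Q\<close>,
  the stuttering property of weak bisimilarity yields \<open>P \<approx> Q\<^sub>1\<close>. For that property a transition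
  has to be simulated from a state reached by \<open>\<tau>\<close>-steps, in which bound names that were fresh
  before may occur. They are renamed away first and, using equivariance, renamed back afterwards.
\<close>

section \<open>Composition of weak transitions, and elementary properties of weak
  bisimilarity\<close>

lemma act_inverse_right:
  assumes "nominal_set srt X" "\<pi> \<in> perms srt" "x \<in> carrier X"
  shows "act X \<pi> (act X (inverse \<pi>) x) = x"
  using nominal_setD(3)[OF assms(1,2) perms_inverse[OF assms(2)] assms(3)]
    nominal_setD(2)[OF assms(1,3)]
  by (simp add: inverse_perm_right)

lemma weak_tau_trans:
  assumes "weak_tau srt T \<tau> P Q" "weak_tau srt T \<tau> Q R"
  shows "weak_tau srt T \<tau> P R"
  using assms by (induction rule: weak_tau.induct) (auto intro: weak_tau.step)

lemma weak_tau_carrier: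
  assumes "weak_tau srt T \<tau> P Q" "P \<in> carrier (states T)"
  shows "Q \<in> carrier (states T)"
  using assms by (induction rule: weak_tau.induct) (auto simp: step_def)

lemma weak_tau_weak_hat_step:
  assumes "weak_tau srt T \<tau> P P1" "weak_hat_step srt T \<tau> P1 \<alpha> P'"
  shows "weak_hat_step srt T \<tau> P \<alpha> P'"
  using assms(2) weak_tau_trans[OF assms(1)]
  unfolding weak_hat_step_def weak_step_def by (auto split: if_splits)

lemma weakly_bisimilarI:
  "weak_bisimulation srt T \<tau> R \<Longrightarrow> (P, Q) \<in> R \<Longrightarrow> weakly_bisimilar srt T \<tau> P Q"
  unfolding weakly_bisimilar_def by blast

lemma weakly_bisimilar_carrier:
  assumes "weakly_bisimilar srt T \<tau> P Q"
  shows "P \<in> carrier (states T)" "Q \<in> carrier (states T)"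
  using assms unfolding weakly_bisimilar_def weak_bisimulation_def by blast+

lemma weakly_bisimilar_sym:
  "weakly_bisimilar srt T \<tau> P Q \<Longrightarrow> weakly_bisimilar srt T \<tau> Q P"
  unfolding weakly_bisimilar_def weak_bisimulation_def by (meson symD)

lemma weakly_bisimilar_sim:
  assumes "weakly_bisimilar srt T \<tau> P Q" "step srt T P \<alpha> P'"
    "bn T \<alpha> \<inter> supp srt (states T) Q = {}"
  obtains Q' where "weak_hat_step srt T \<tau> Q \<alpha> Q'" "weakly_bisimilar srt T \<tau> P' Q'"
proof -
  obtain R where R: "weak_bisimulation srt T \<tau> R" "(P, Q) \<in> R"
    using assms(1) unfolding weakly_bisimilar_def by blast
  moreover have "\<alpha> \<in> carrier (acts T)" using assms(2) by (simp add: step_def)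
  ultimately obtain Q' where "weak_hat_step srt T \<tau> Q \<alpha> Q'" "(P', Q') \<in> R"
    using assms(2,3) unfolding weak_bisimulation_def by blast
  then show thesis using that weakly_bisimilarI[OF R(1)] by blast
qed

lemma weakly_bisimilar_static:
  assumes "weakly_bisimilar srt T \<tau> P Q" "(P, \<phi>) \<in> sat T"
  obtains Q' where "weak_tau srt T \<tau> Q Q'" "(Q', \<phi>) \<in> sat T" "weakly_bisimilar srt T \<tau> P Q'"
proof -
  obtain R where R: "weak_bisimulation srt T \<tau> R" "(P, Q) \<in> R"
    using assms(1) unfolding weakly_bisimilar_def by blast
  then obtain Q' where "weak_tau srt T \<tau> Q Q'" "(Q', \<phi>) \<in> sat T" "(P, Q') \<in> R"
    using assms(2) unfolding weak_bisimulation_def by blast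
  then show thesis using that weakly_bisimilarI[OF R(1)] by blast
qed

section \<open>Equivariance of weak transitions and of weak bisimilarity\<close>

context
  fixes srt :: "'n \<Rightarrow> 's" and T :: "('n, 'st, 'pr, 'ac) nts" and \<tau> :: 'ac
  assumes srt: "name_sorting srt" and nts: "nominal_transition_system srt T"
    and tau: "\<tau> \<in> carrier (acts T)" "supp srt (acts T) \<tau> = {}"
begin

text \<open>The support of an element is itself a supporting set by \<open>supp_supports\<close>.
  Here it is empty, so a permutation has no names to fix.\<close>

lemma act_tau: "\<pi> \<in> perms srt \<Longrightarrow> act (acts T) \<pi> \<tau> = \<tau>"
  using supp_supports(2)[OF srt nts_nominal(3)[OF srt nts] tau(1)] tau(2)
  unfolding supports_def by simp

lemma bn_tau: "bn T \<tau> = {}"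
  using nts_bn(2)[OF srt nts tau(1)] tau(2) by blast

lemma weak_tau_act:
  assumes "weak_tau srt T \<tau> P P'" "\<pi> \<in> perms srt"
  shows "weak_tau srt T \<tau> (act (states T) \<pi> P) (act (states T) \<pi> P')"
  using assms(1)
proof induction
  case (step P P'' P')
  then show ?case
    using step_act[OF srt nts step.hyps(1) assms(2)] act_tau[OF assms(2)]
    by (auto intro: weak_tau.step)
qed (rule weak_tau.refl)

lemma weak_hat_step_act:
  assumes h: "weak_hat_step srt T \<tau> P \<alpha> P'" and p: "\<pi> \<in> perms srt" and a: "\<alpha> \<in> carrier (acts T)"
  shows "weak_hat_step srt T \<tau> (act (states T) \<pi> P) (act (acts T) \<pi> \<alpha>) (act (states T) \<pi> P')"
proof -
  \<comment> \<open>The case distinction in \<open>weak_hat_step\<close> is invariant: \<tau> is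
    fixed by \<pi> and by its inverse, so no other action is sent to it.\<close>
  have "act (acts T) \<pi> \<alpha> = \<tau> \<longleftrightarrow> \<alpha> = \<tau>"
    using act_tau[OF p] act_tau[OF perms_inverse[OF p]]
      act_inverse_left[OF nts_nominal(3)[OF srt nts] p a] by metis
  then show ?thesis
    using h weak_tau_act[OF _ p] step_act[OF srt nts _ p]
    unfolding weak_hat_step_def weak_step_def by (simp split: if_splits) blast
qed

text \<open>Alpha-conversion of a transition: as \<pi> fixes the support of the residual outside
  \<open>bn T \<alpha>\<close>, the renamed residual represents the same class. Unlike in
  \<open>step_act\<close>, the source \<open>P\<close> stays as it is.\<close>

lemma step_rename:
  assumes s: "step srt T P \<alpha> P'" and p: "\<pi> \<in> perms srt"
    and fx: "\<And>a. a \<in> supp srt (residuals T) (\<alpha>, P') - bn T \<alpha> \<Longrightarrow> Perm.apply \<pi> a = a"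
  shows "step srt T P (act (acts T) \<pi> \<alpha>) (act (states T) \<pi> P')"
proof -
  note X = nts_nominal[OF srt nts]
  have c: "\<alpha> \<in> carrier (acts T)" "P' \<in> carrier (states T)"
    using s by (auto simp: step_def)
  have xc: "(\<alpha>, P') \<in> carrier (residuals T)"
    using c by (simp add: prod_permset_simps)
  have fin: "finite (bn T \<alpha>)" by (rule nts_bn(1)[OF srt nts c(1)])
  have "((bn T \<alpha>, (\<alpha>, P')), (Perm.apply \<pi> ` bn T \<alpha>, act (residuals T) \<pi> (\<alpha>, P')))
      \<in> alpha_rel srt (residuals T)"
    by (rule alpha_relI[OF fin xc X(4) p fx])
  then have "abstr srt (residuals T) (bn T \<alpha>) (\<alpha>, P') =
      abstr srt (residuals T) (Perm.apply \<pi> ` bn T \<alpha>) (act (residuals T) \<pi> (\<alpha>, P'))"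
    using abstr_eq_iff[OF X(4) fin xc] fin nominal_setD(1)[OF X(4) p xc] by simp
  then show ?thesis
    using s nominal_setD(1)[OF X(1) p c(2)] nominal_setD(1)[OF X(3) p c(1)]
    by (simp add: step_def nts_bn(3)[OF srt nts p c(1)] prod_permset_simps)
qed

lemma sat_act_inverse:
  assumes "\<pi> \<in> perms srt" "P \<in> carrier (states T)" "(act (states T) \<pi> P, \<phi>) \<in> sat T"
  shows "(P, act (preds T) (inverse \<pi>) \<phi>) \<in> sat T"
  using sat_act[OF srt nts assms(3) perms_inverse[OF assms(1)]]
    act_inverse_left[OF nts_nominal(1)[OF srt nts] assms(1,2)] by simp

text \<open>The image of weak bisimilarity under \<pi> is a weak bisimulation: a challenge is pulled
  back along \<open>inverse \<pi>\<close>, answered there, and the answer is pushed forward along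
  \<pi>.\<close>

lemma weakly_bisimilar_act:
  assumes b: "weakly_bisimilar srt T \<tau> P Q" and p: "\<pi> \<in> perms srt"
  shows "weakly_bisimilar srt T \<tau> (act (states T) \<pi> P) (act (states T) \<pi> Q)"
proof -
  note X = nts_nominal[OF srt nts]
  note ip = perms_inverse[OF p]
  let ?R = "{(act (states T) \<pi> P, act (states T) \<pi> Q) | P Q. weakly_bisimilar srt T \<tau> P Q}"
  have "weak_bisimulation srt T \<tau> ?R"
    unfolding weak_bisimulation_def
  proof (intro conjI ballI)
    show "?R \<subseteq> carrier (states T) \<times> carrier (states T)"
      using weakly_bisimilar_carrier nominal_setD(1)[OF X(1) p] by fast
    show "sym ?R" by (rule symI) (blast intro: weakly_bisimilar_sym)
    fix z assume "z \<in> ?R"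
    then obtain P Q where z: "z = (act (states T) \<pi> P, act (states T) \<pi> Q)"
      and b: "weakly_bisimilar srt T \<tau> P Q" by blast
    note c = weakly_bisimilar_carrier[OF b]
    have "\<exists>Q'. weak_hat_step srt T \<tau> (act (states T) \<pi> Q) \<alpha> Q' \<and> (P', Q') \<in> ?R"
      if a: "\<alpha> \<in> carrier (acts T)" and fr: "bn T \<alpha> \<inter> supp srt (states T) (act (states T) \<pi> Q) = {}"
        and s: "step srt T (act (states T) \<pi> P) \<alpha> P'" for \<alpha> P'
    proof -
      let ?\<alpha> = "act (acts T) (inverse \<pi>) \<alpha>" and ?P' = "act (states T) (inverse \<pi>) P'"
      have s': "step srt T P ?\<alpha> ?P'"
        using step_act[OF srt nts s ip] act_inverse_left[OF X(1) p c(1)] by simp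
      have "bn T ?\<alpha> \<inter> supp srt (states T) Q = {}"
        using fr nts_bn(3)[OF srt nts ip a] supp_act[OF X(1) p c(2)] by force
      then obtain Q' where Q': "weak_hat_step srt T \<tau> Q ?\<alpha> Q'" "weakly_bisimilar srt T \<tau> ?P' Q'"
        by (rule weakly_bisimilar_sim[OF b s'])
      have "P' \<in> carrier (states T)" using s by (simp add: step_def)
      then have "(P', act (states T) \<pi> Q') \<in> ?R"
        using Q'(2) act_inverse_right[OF X(1) p, of P', symmetric] by blast
      moreover have "weak_hat_step srt T \<tau> (act (states T) \<pi> Q) \<alpha> (act (states T) \<pi> Q')"
        using weak_hat_step_act[OF Q'(1) p nominal_setD(1)[OF X(3) ip a]]
          act_inverse_right[OF X(3) p a] by simp
      ultimately show ?thesis by blast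
    qed
    moreover have "\<exists>Q'. weak_tau srt T \<tau> (act (states T) \<pi> Q) Q' \<and> (Q', \<phi>) \<in> sat T \<and>
        (act (states T) \<pi> P, Q') \<in> ?R"
      if s: "(act (states T) \<pi> P, \<phi>) \<in> sat T" for \<phi>
    proof -
      obtain Q' where Q': "weak_tau srt T \<tau> Q Q'" "(Q', act (preds T) (inverse \<pi>) \<phi>) \<in> sat T"
        "weakly_bisimilar srt T \<tau> P Q'"
        by (rule weakly_bisimilar_static[OF b sat_act_inverse[OF p c(1) s]])
      have "\<phi> \<in> carrier (preds T)" using nts_sat_carrier[OF srt nts s] by blast
      then have "(act (states T) \<pi> Q', \<phi>) \<in> sat T"
        using sat_act[OF srt nts Q'(2) p] act_inverse_right[OF X(2) p] by simp
      then show ?thesis using weak_tau_act[OF Q'(1) p] Q'(3) by blast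
    qed
    ultimately show "case z of (P, Q) \<Rightarrow>
        (\<forall>\<alpha>\<in>carrier (acts T). \<forall>P'. bn T \<alpha> \<inter> supp srt (states T) Q = {} \<longrightarrow> step srt T P \<alpha> P' \<longrightarrow>
           (\<exists>Q'. weak_hat_step srt T \<tau> Q \<alpha> Q' \<and> (P', Q') \<in> ?R)) \<and>
        (\<forall>\<phi>. (P, \<phi>) \<in> sat T \<longrightarrow>
           (\<exists>Q'. weak_tau srt T \<tau> Q Q' \<and> (Q', \<phi>) \<in> sat T \<and> (P, Q') \<in> ?R))"
      unfolding z prod.case by blast
  qed
  then show ?thesis by (rule weakly_bisimilarI) (use b in blast)
qed

section \<open>Simulation across preceding \<tau>-steps, and stuttering\<close>

text \<open>The bound names of \<alpha> are fresh for \<open>Q\<close> but may occur in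
  \<open>Q1\<close>, where the simulation starts. They are renamed by \<rho>, the transition is
  simulated from \<open>Q1\<close>, and the whole weak transition from \<open>Q\<close> is renamed
  back.\<close>

lemma weakly_bisimilar_sim_weak_tau:
  assumes b: "weakly_bisimilar srt T \<tau> P Q1" and w: "weak_tau srt T \<tau> Q Q1"
    and Q: "Q \<in> carrier (states T)" and s: "step srt T P \<alpha> P'"
    and fr: "bn T \<alpha> \<inter> supp srt (states T) Q = {}"
  obtains Q' where "weak_hat_step srt T \<tau> Q \<alpha> Q'" "weakly_bisimilar srt T \<tau> P' Q'"
proof -
  note X = nts_nominal[OF srt nts]
  have a: "\<alpha> \<in> carrier (acts T)" and P': "P' \<in> carrier (states T)"
    using s by (auto simp: step_def)
  then have xc: "(\<alpha>, P') \<in> carrier (residuals T)" by (simp add: prod_permset_simps)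
  \<comment> \<open>Each component serves one purpose: avoiding the support of \<open>Q1\<close>
    permits the simulation, fixing that of the residual outside \<open>bn T \<alpha>\<close> permits
    \<open>step_rename\<close>, and fixing that of \<open>Q\<close> lets \<open>Q\<close> survive
    the renaming back.\<close>
  let ?A = "supp srt (states T) Q \<union> supp srt (states T) Q1 \<union> supp srt (residuals T) (\<alpha>, P')"
  have fin: "finite ?A"
    using supp_supports(1)[OF srt X(1)] Q weakly_bisimilar_carrier(2)[OF b]
      supp_supports(1)[OF srt X(4) xc] by simp
  obtain \<rho> where r: "\<rho> \<in> perms srt" "Perm.apply \<rho> ` bn T \<alpha> \<inter> ?A = {}"
    "\<forall>a\<in>?A - bn T \<alpha>. Perm.apply \<rho> a = a"
    using fresh_renaming[OF srt nts_bn(1)[OF srt nts a] fin] by (elim bexE conjE)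
  note ir = perms_inverse[OF r(1)]
  let ?\<alpha> = "act (acts T) \<rho> \<alpha>"
  have s': "step srt T P ?\<alpha> (act (states T) \<rho> P')"
    using step_rename[OF s r(1)] r(3) by blast
  have "bn T ?\<alpha> \<inter> supp srt (states T) Q1 = {}"
    using r(2) nts_bn(3)[OF srt nts r(1) a] by blast
  then obtain Q' where Q': "weak_hat_step srt T \<tau> Q1 ?\<alpha> Q'"
    "weakly_bisimilar srt T \<tau> (act (states T) \<rho> P') Q'"
    by (rule weakly_bisimilar_sim[OF b s'])
  let ?Q' = "act (states T) (inverse \<rho>) Q'"
  \<comment> \<open>By \<open>fr\<close> the support of \<open>Q\<close> lies in
    \<open>?A - bn T \<alpha>\<close>, which \<rho> fixes pointwise.\<close>
  have "act (states T) \<rho> Q = Q"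
    using supp_supports(2)[OF srt X(1) Q] r(1,3) fr unfolding supports_def by blast
  then have "act (states T) (inverse \<rho>) Q = Q"
    using act_inverse_left[OF X(1) r(1) Q] by simp
  then have "weak_hat_step srt T \<tau> Q \<alpha> ?Q'"
    using weak_hat_step_act[OF weak_tau_weak_hat_step[OF w Q'(1)] ir nominal_setD(1)[OF X(3) r(1) a]]
      act_inverse_left[OF X(3) r(1) a] by simp
  moreover have "weakly_bisimilar srt T \<tau> P' ?Q'"
    using weakly_bisimilar_act[OF Q'(2) ir] act_inverse_left[OF X(1) r(1) P'] by simp
  ultimately show thesis by (rule that)
qed

lemma weakly_bisimilar_weak_tau:
  assumes "weak_tau srt T \<tau> P P'" "weakly_bisimilar srt T \<tau> P Q"
  obtains Q' where "weak_tau srt T \<tau> Q Q'" "weakly_bisimilar srt T \<tau> P' Q'"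
proof -
  have "\<exists>Q'. weak_tau srt T \<tau> Q Q' \<and> weakly_bisimilar srt T \<tau> P' Q'"
    using assms
  proof (induction arbitrary: Q)
    case (refl P)
    then show ?case by (blast intro: weak_tau.refl)
  next
    case (step P P'' P')
    obtain Q'' where "weak_hat_step srt T \<tau> Q \<tau> Q''" "weakly_bisimilar srt T \<tau> P'' Q''"
      by (rule weakly_bisimilar_sim[OF step.prems step.hyps(1)]) (simp_all add: bn_tau)
    then show ?case
      using step.IH by (metis weak_hat_step_def weak_tau_trans)
  qed
  then show thesis using that by blast
qed

text \<open>Weak bisimilarity extended by \<open>(P, Q1)\<close> and its converse is shown to be a
  weak bisimulation.\<close>

theorem weakly_bisimilar_stuttering:
  assumes "weakly_bisimilar srt T \<tau> P Q" "weak_tau srt T \<tau> Q Q1" "weak_tau srt T \<tau> Q1 Q'"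
    "weakly_bisimilar srt T \<tau> P Q'"
  shows "weakly_bisimilar srt T \<tau> P Q1"
proof -
  let ?B = "{(P, Q). weakly_bisimilar srt T \<tau> P Q}"
  let ?R = "?B \<union> {(P, Q1), (Q1, P)}"
  have cP: "P \<in> carrier (states T)" and cQ1: "Q1 \<in> carrier (states T)"
    using weakly_bisimilar_carrier[OF assms(1)] weak_tau_carrier[OF assms(2)] by auto
  obtain P1 where P1: "weak_tau srt T \<tau> P P1" "weakly_bisimilar srt T \<tau> Q1 P1"
    by (rule weakly_bisimilar_weak_tau[OF assms(2) weakly_bisimilar_sym[OF assms(1)]])
  \<comment> \<open>The uniform property of all pairs, old and new: the right component reaches by
    \<tau>-steps a state bisimilar to the left one. For the new pairs this state is
    \<open>Q'\<close> or \<open>P1\<close>; every challenge is answered from it, with the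
    \<tau>-steps put in front.\<close>
  have red: "V \<in> carrier (states T) \<and> (\<exists>V1. weak_tau srt T \<tau> V V1 \<and> weakly_bisimilar srt T \<tau> U V1)"
    if "(U, V) \<in> ?R" for U V
    using that
  proof safe
    assume "weakly_bisimilar srt T \<tau> U V"
    then show "V \<in> carrier (states T)" by (rule weakly_bisimilar_carrier)
  qed (use assms P1 cP cQ1 in \<open>auto intro: weak_tau.refl\<close>)
  have "weak_bisimulation srt T \<tau> ?R"
    unfolding weak_bisimulation_def
  proof (intro conjI ballI)
    show "?R \<subseteq> carrier (states T) \<times> carrier (states T)"
      using weakly_bisimilar_carrier cP cQ1 by fast
    show "sym ?R" by (rule symI) (blast intro: weakly_bisimilar_sym)
    fix z assume z: "z \<in> ?R"
    obtain U V where zz: "z = (U, V)" by (cases z)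
    obtain V1 where V1: "weak_tau srt T \<tau> V V1" "weakly_bisimilar srt T \<tau> U V1"
      and cV: "V \<in> carrier (states T)"
      using red z zz by blast
    have "\<exists>V'. weak_hat_step srt T \<tau> V \<alpha> V' \<and> (U', V') \<in> ?R"
      if "bn T \<alpha> \<inter> supp srt (states T) V = {}" "step srt T U \<alpha> U'" for \<alpha> U'
      using weakly_bisimilar_sim_weak_tau[OF V1(2,1) cV that(2,1)] by blast
    moreover have "\<exists>V'. weak_tau srt T \<tau> V V' \<and> (V', \<phi>) \<in> sat T \<and> (U, V') \<in> ?R"
      if "(U, \<phi>) \<in> sat T" for \<phi>
      using weakly_bisimilar_static[OF V1(2) that] weak_tau_trans[OF V1(1)] by blast
    ultimately show "case z of (P, Q) \<Rightarrow>
        (\<forall>\<alpha>\<in>carrier (acts T). \<forall>P'. bn T \<alpha> \<inter> supp srt (states T) Q = {} \<longrightarrow> step srt T P \<alpha> P' \<longrightarrow>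
           (\<exists>Q'. weak_hat_step srt T \<tau> Q \<alpha> Q' \<and> (P', Q') \<in> ?R)) \<and>
        (\<forall>\<phi>. (P, \<phi>) \<in> sat T \<longrightarrow>
           (\<exists>Q'. weak_tau srt T \<tau> Q Q' \<and> (Q', \<phi>) \<in> sat T \<and> (P, Q') \<in> ?R))"
      unfolding zz prod.case by blast
  qed
  then show ?thesis by (rule weakly_bisimilarI) blast
qed

end

section \<open>Transfer from the system with predicates as actions\<close>

lemma weak_tau_preds_to_acts:
  assumes "name_sorting srt" "nominal_transition_system srt T"
  shows "weak_tau srt (preds_to_acts srt T) (Inl \<tau>) P Q \<longleftrightarrow> weak_tau srt T \<tau> P Q"
proof
  show "weak_tau srt T \<tau> P Q" if "weak_tau srt (preds_to_acts srt T) (Inl \<tau>) P Q"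
    using that
    by induction (auto simp: step_preds_to_acts_Inl[OF assms] intro: weak_tau.intros)
  show "weak_tau srt (preds_to_acts srt T) (Inl \<tau>) P Q" if "weak_tau srt T \<tau> P Q"
    using that
  proof induction
    case (step P P'' P')
    then show ?case
      by (intro weak_tau.step[of _ _ P _ P'']) (simp_all add: step_preds_to_acts_Inl[OF assms])
  qed (rule weak_tau.refl)
qed

text \<open>Since \<open>Inl\<close> is injective, both systems take the same branch of
  \<open>weak_hat_step\<close>.\<close>

lemma weak_hat_step_preds_to_acts:
  assumes "name_sorting srt" "nominal_transition_system srt T"
  shows "weak_hat_step srt (preds_to_acts srt T) (Inl \<tau>) P (Inl \<alpha>) Q \<longleftrightarrow> weak_hat_step srt T \<tau> P \<alpha> Q"
  by (simp add: weak_hat_step_def weak_step_def weak_tau_preds_to_acts[OF assms]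
      step_preds_to_acts_Inl[OF assms])

theorem theorem8p8:
  fixes srt :: "'n \<Rightarrow> 's"
    and T :: "('n, 'st, 'pr, 'ac) nts"
    and \<tau> :: 'ac
    and P Q :: 'st
  assumes "name_sorting srt"
    and "nominal_transition_system srt T"
    and "\<tau> \<in> carrier (acts T)" and "supp srt (acts T) \<tau> = {}"
    and "P \<in> carrier (states T)" and "Q \<in> carrier (states T)"
    and "weakly_bisimilar srt (preds_to_acts srt T) (Inl \<tau>) P Q"
  shows "weakly_bisimilar srt T \<tau> P Q"
proof -
  let ?S = "preds_to_acts srt T"
  let ?R = "{(P, Q). weakly_bisimilar srt ?S (Inl \<tau>) P Q}"
  note wtau = weak_tau_preds_to_acts[OF assms(1,2)]
  note S = nominal_transition_system_preds_to_acts[OF assms(1,2)]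
  \<comment> \<open>Together with \<open>S\<close> this makes the stuttering property available in
    \<open>?S\<close>.\<close>
  have tauS: "Inl \<tau> \<in> carrier (acts ?S)" "supp srt (acts ?S) (Inl \<tau>) = {}"
    using assms(3,4) by (simp_all add: supp_Inl) (simp add: sum_permset_def InlI)
  have "weak_bisimulation srt T \<tau> ?R"
    unfolding weak_bisimulation_def
  proof (intro conjI ballI)
    show "?R \<subseteq> carrier (states T) \<times> carrier (states T)"
      using weakly_bisimilar_carrier[of srt ?S] by auto
    show "sym ?R" by (rule symI) (blast intro: weakly_bisimilar_sym)
    fix z assume "z \<in> ?R"
    then obtain P Q where z: "z = (P, Q)" and b: "weakly_bisimilar srt ?S (Inl \<tau>) P Q" by blast
    have "\<exists>Q'. weak_hat_step srt T \<tau> Q \<alpha> Q' \<and> (P', Q') \<in> ?R"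
      if fr: "bn T \<alpha> \<inter> supp srt (states T) Q = {}" and s: "step srt T P \<alpha> P'" for \<alpha> P'
    proof -
      have "step srt ?S P (Inl \<alpha>) P'"
        using s by (simp add: step_preds_to_acts_Inl[OF assms(1,2)])
      then obtain Q' where "weak_hat_step srt ?S (Inl \<tau>) Q (Inl \<alpha>) Q'"
        "weakly_bisimilar srt ?S (Inl \<tau>) P' Q'"
        by (rule weakly_bisimilar_sim[OF b]) (use fr in auto)
      then show ?thesis by (auto simp: weak_hat_step_preds_to_acts[OF assms(1,2)])
    qed
    moreover have "\<exists>Q'. weak_tau srt T \<tau> Q Q' \<and> (Q', \<phi>) \<in> sat T \<and> (P, Q') \<in> ?R"
      if "(P, \<phi>) \<in> sat T" for \<phi>
    proof -
      \<comment> \<open>A predicate becomes a challenge with an action that binds nothing, so it can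
        be simulated from any bisimilar \<open>Q\<close>.\<close>
      have "step srt ?S P (Inr \<phi>) P"
        using that by (simp add: step_preds_to_acts_Inr[OF assms(1,2)])
      then obtain Q' where "weak_hat_step srt ?S (Inl \<tau>) Q (Inr \<phi>) Q'"
        and b': "weakly_bisimilar srt ?S (Inl \<tau>) P Q'"
        by (rule weakly_bisimilar_sim[OF b]) auto
      \<comment> \<open>\<open>Inr \<phi>\<close> differs from \<open>Inl \<tau>\<close>, so the
        answer contains an actual \<phi>-transition. This is a loop, hence the same
        \<open>Q1\<close> stands before and after it.\<close>
      then obtain Q1 where Q1: "weak_tau srt ?S (Inl \<tau>) Q Q1" "(Q1, \<phi>) \<in> sat T"
        "weak_tau srt ?S (Inl \<tau>) Q1 Q'"
        by (auto simp: weak_hat_step_def weak_step_def step_preds_to_acts_Inr[OF assms(1,2)])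
      have "weakly_bisimilar srt ?S (Inl \<tau>) P Q1"
        by (rule weakly_bisimilar_stuttering[OF assms(1) S tauS b Q1(1,3) b'])
      then show ?thesis using Q1(1,2) wtau by blast
    qed
    ultimately show "case z of (P, Q) \<Rightarrow>
        (\<forall>\<alpha>\<in>carrier (acts T). \<forall>P'. bn T \<alpha> \<inter> supp srt (states T) Q = {} \<longrightarrow> step srt T P \<alpha> P' \<longrightarrow>
           (\<exists>Q'. weak_hat_step srt T \<tau> Q \<alpha> Q' \<and> (P', Q') \<in> ?R)) \<and>
        (\<forall>\<phi>. (P, \<phi>) \<in> sat T \<longrightarrow>
           (\<exists>Q'. weak_tau srt T \<tau> Q Q' \<and> (Q', \<phi>) \<in> sat T \<and> (P, Q') \<in> ?R))"
      unfolding z prod.case by blast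
  qed
  then show ?thesis by (rule weakly_bisimilarI) (use assms(7) in blast)
qed

end
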